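(* Let $G$ and $H$ be groups, let $M$ be an abelian subgroup of $\operatorname{Aut}(H)$, and let $\mathcal{S}$ be the set of group homomorphisms $\alpha\colon G\to M$. Then $((G\times H,\circ_\alpha)\mid\alpha\in\mathcal{S})$ is a brace block.
   Context: For a group homomorphism $\alpha\colon G\to\operatorname{Aut}(H)$, $\circ_\alpha$ denotes the group operation on $G\times H$ of the semidirect product: $(g,h)\circ_\alpha(g',h')=(gg',\,h\,\alpha(g)(h'))$. A skew brace (meaning skew left brace) is a set $A$ with two group structures $(A,\cdot)$ and $(A,\circ)$ such that $a\circ(b\cdot c)=(a\circ b)\cdot a^{-1}\cdot(a\circ c)$ for all $a,b,c\in A$, where $a^{-1}$ is the inverse of $a$ in $(A,\cdot)$. A bi-skew brace is a skew brace $(A,\cdot,\circ)$ such that $(A,\circ,\cdot)$ is also a skew brace. A brace block on a set $A$ is a family $((A,\circ_i)\mid i\in I)$ of group operations $\circ_i$ on $A$ such that $(A,\circ_i,\circ_j)$ is a bi-skew brace for all $i,j\in I$. *)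

theory Defs
  imports "HOL-Algebra.Bij"
begin

text \<open>A set with two group structures is given by two group records \<open>D\<close> (the operation written
  as a dot) and \<open>C\<close> (the circle operation) with the same carrier.\<close>

locale skew_brace = dot: group D + circ: group C
  for D :: "('a, 'm) monoid_scheme" and C :: "('a, 'n) monoid_scheme" +
  assumes carrier_eq: "carrier C = carrier D"
    and brace_law:
      "\<lbrakk>a \<in> carrier D; b \<in> carrier D; c \<in> carrier D\<rbrakk> \<Longrightarrow>
        a \<otimes>\<^bsub>C\<^esub> (b \<otimes>\<^bsub>D\<^esub> c) = (a \<otimes>\<^bsub>C\<^esub> b) \<otimes>\<^bsub>D\<^esub> inv\<^bsub>D\<^esub> a \<otimes>\<^bsub>D\<^esub> (a \<otimes>\<^bsub>C\<^esub> c)"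

definition bi_skew_brace :: "('a, 'm) monoid_scheme \<Rightarrow> ('a, 'n) monoid_scheme \<Rightarrow> bool" where
  "bi_skew_brace D C \<longleftrightarrow> skew_brace D C \<and> skew_brace C D"

definition brace_block :: "'a set \<Rightarrow> 'i set \<Rightarrow> ('i \<Rightarrow> ('a, 'm) monoid_scheme) \<Rightarrow> bool" where
  "brace_block A I F \<longleftrightarrow>
    (\<forall>i\<in>I. group (F i) \<and> carrier (F i) = A) \<and>
    (\<forall>i\<in>I. \<forall>j\<in>I. bi_skew_brace (F i) (F j))"

definition semidirect ::
  "('g, 'm) monoid_scheme \<Rightarrow> ('h, 'n) monoid_scheme \<Rightarrow> ('g \<Rightarrow> 'h \<Rightarrow> 'h) \<Rightarrow> ('g \<times> 'h) monoid" where
  "semidirect G H \<alpha> =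
    \<lparr>carrier = carrier G \<times> carrier H,
     mult = (\<lambda>(g, h) (g', h'). (g \<otimes>\<^bsub>G\<^esub> g', h \<otimes>\<^bsub>H\<^esub> \<alpha> g h')),
     one = (\<one>\<^bsub>G\<^esub>, \<one>\<^bsub>H\<^esub>)\<rparr>"

end

theory Submission
  imports Defs
begin

text \<open>In a skew brace with dot operation \<open>\<cdot>\<close> and circle operation \<open>\<circ>\<close>, the brace law says that
  the maps \<open>\<lambda>\<^sub>a(c) = a\<^sup>-\<^sup>1 \<cdot> (a \<circ> c)\<close> satisfy \<open>a \<circ> (b \<cdot> c) = (a \<circ> b) \<cdot> \<lambda>\<^sub>a(c)\<close>. When \<open>\<cdot>\<close> is the
  semidirect product for \<open>\<alpha>\<close> and \<open>\<circ>\<close> the one for \<open>\<beta>\<close>, the first coordinates of \<open>a\<close> cancel and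
  \<open>\<lambda>\<^bsub>(g,h)\<^esub>(g', h') = (g', \<alpha>(g)\<^sup>-\<^sup>1 (\<beta>(g) h'))\<close> (lemma \<open>semidirect_lambda\<close>). For \<open>a = (g, h)\<close>,
  \<open>b = (k, l)\<close> and \<open>c = (g', h')\<close> both sides of the brace law have first coordinate \<open>g k g'\<close>, and
  their second coordinates are \<open>h \<beta>(g)(l)\<close> times \<open>\<beta>(g) (\<alpha>(k) h')\<close> and
  \<open>\<alpha>(g k) (\<alpha>(g)\<^sup>-\<^sup>1 (\<beta>(g) h'))\<close> respectively. These agree as soon as the values of \<open>\<alpha>\<close> and \<open>\<beta>\<close>
  generate an abelian group, in particular when they all lie in \<open>M\<close>.
  That condition is symmetric in \<open>\<alpha>\<close> and \<open>\<beta>\<close>, so the same computation with the two operations exchanged gives a bi-skew brace.\<close>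

text \<open>Multiplication in the automorphism group is composition restricted to the carrier. This
  lemma and the next translate membership in a homomorphism set into pointwise
  equations, in which the restriction no longer appears.\<close>

lemma mult_AutoGroup_apply:
  assumes "f \<in> carrier (AutoGroup H)" "f' \<in> carrier (AutoGroup H)" "h \<in> carrier H"
  shows "(f \<otimes>\<^bsub>AutoGroup H\<^esub> f') h = f (f' h)"
  using assms by (simp add: AutoGroup_def BijGroup_def auto_def compose_def)

lemma hom_AutoGroup_action:
  assumes G: "group G" and H: "group H" and \<alpha>: "\<alpha> \<in> hom G (AutoGroup H)"
  shows hom_AutoGroup_carrier: "g \<in> carrier G \<Longrightarrow> \<alpha> g \<in> carrier (AutoGroup H)"
    and hom_AutoGroup_closed:
      "\<lbrakk>g \<in> carrier G; h \<in> carrier H\<rbrakk> \<Longrightarrow> \<alpha> g h \<in> carrier H"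
    and hom_AutoGroup_distrib:
      "\<lbrakk>g \<in> carrier G; h \<in> carrier H; h' \<in> carrier H\<rbrakk>
        \<Longrightarrow> \<alpha> g (h \<otimes>\<^bsub>H\<^esub> h') = \<alpha> g h \<otimes>\<^bsub>H\<^esub> \<alpha> g h'"
    and hom_AutoGroup_mult:
      "\<lbrakk>g \<in> carrier G; g' \<in> carrier G; h \<in> carrier H\<rbrakk> \<Longrightarrow> \<alpha> (g \<otimes>\<^bsub>G\<^esub> g') h = \<alpha> g (\<alpha> g' h)"
    and hom_AutoGroup_one: "h \<in> carrier H \<Longrightarrow> \<alpha> \<one>\<^bsub>G\<^esub> h = h"
proof -
  show carr: "\<alpha> g \<in> carrier (AutoGroup H)" if "g \<in> carrier G" for g
    using \<alpha> that by (auto simp: hom_def)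
  then have hom: "\<alpha> g \<in> hom H H" if "g \<in> carrier G" for g
    using that by (auto simp: AutoGroup_def auto_def)
  show "\<alpha> g h \<in> carrier H" if "g \<in> carrier G" "h \<in> carrier H" for g h
    using hom that by (auto simp: hom_def)
  show "\<alpha> g (h \<otimes>\<^bsub>H\<^esub> h') = \<alpha> g h \<otimes>\<^bsub>H\<^esub> \<alpha> g h'"
    if "g \<in> carrier G" "h \<in> carrier H" "h' \<in> carrier H" for g h h'
    using hom that by (auto simp: hom_def)
  show "\<alpha> (g \<otimes>\<^bsub>G\<^esub> g') h = \<alpha> g (\<alpha> g' h)"
    if "g \<in> carrier G" "g' \<in> carrier G" "h \<in> carrier H" for g g' h
    using \<alpha> that by (simp add: hom_mult mult_AutoGroup_apply carr)
  have "\<alpha> \<one>\<^bsub>G\<^esub> = \<one>\<^bsub>AutoGroup H\<^esub>"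
    by (rule hom_one[OF \<alpha> G group.AutoGroup[OF H]])
  then show "\<alpha> \<one>\<^bsub>G\<^esub> h = h" if "h \<in> carrier H" for h
    using that by (simp add: AutoGroup_def BijGroup_def)
qed

lemma carrier_semidirect [simp]: "carrier (semidirect G H \<alpha>) = carrier G \<times> carrier H"
  by (simp add: semidirect_def)

lemma mult_semidirect [simp]:
  "(g, h) \<otimes>\<^bsub>semidirect G H \<alpha>\<^esub> (g', h') = (g \<otimes>\<^bsub>G\<^esub> g', h \<otimes>\<^bsub>H\<^esub> \<alpha> g h')"
  by (simp add: semidirect_def)

lemma one_semidirect [simp]: "\<one>\<^bsub>semidirect G H \<alpha>\<^esub> = (\<one>\<^bsub>G\<^esub>, \<one>\<^bsub>H\<^esub>)"
  by (simp add: semidirect_def)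

lemma group_semidirect:
  assumes G: "group G" and H: "group H" and \<alpha>: "\<alpha> \<in> hom G (AutoGroup H)"
  shows "group (semidirect G H \<alpha>)"
proof -
  interpret G: group G by (rule G)
  interpret H: group H by (rule H)
  note act = hom_AutoGroup_action(2-5)[OF G H \<alpha>]
  show ?thesis
  proof (rule groupI)
    fix x y z
    assume "x \<in> carrier (semidirect G H \<alpha>)" "y \<in> carrier (semidirect G H \<alpha>)"
      "z \<in> carrier (semidirect G H \<alpha>)"
    then show "(x \<otimes>\<^bsub>semidirect G H \<alpha>\<^esub> y) \<otimes>\<^bsub>semidirect G H \<alpha>\<^esub> z =
        x \<otimes>\<^bsub>semidirect G H \<alpha>\<^esub> (y \<otimes>\<^bsub>semidirect G H \<alpha>\<^esub> z)"
      by (auto simp: act G.m_assoc H.m_assoc)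
  next
    fix x assume "x \<in> carrier (semidirect G H \<alpha>)"
    then obtain g h where x: "x = (g, h)" and gh: "g \<in> carrier G" "h \<in> carrier H" by auto
    have "(inv\<^bsub>G\<^esub> g, \<alpha> (inv\<^bsub>G\<^esub> g) (inv\<^bsub>H\<^esub> h)) \<otimes>\<^bsub>semidirect G H \<alpha>\<^esub> x = \<one>\<^bsub>semidirect G H \<alpha>\<^esub>"
    proof -
      have "\<alpha> (inv\<^bsub>G\<^esub> g) (inv\<^bsub>H\<^esub> h) \<otimes>\<^bsub>H\<^esub> \<alpha> (inv\<^bsub>G\<^esub> g) h = \<alpha> (inv\<^bsub>G\<^esub> g) \<one>\<^bsub>H\<^esub>"
        using gh by (simp flip: act(2))
      also have "\<dots> = \<one>\<^bsub>H\<^esub>"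
        using gh by (metis act(1,2) G.inv_closed H.one_closed H.r_one H.r_cancel_one)
      finally show ?thesis using gh by (simp add: x)
    qed
    then show "\<exists>y\<in>carrier (semidirect G H \<alpha>). y \<otimes>\<^bsub>semidirect G H \<alpha>\<^esub> x = \<one>\<^bsub>semidirect G H \<alpha>\<^esub>"
      using gh by (intro bexI[of _ "(inv\<^bsub>G\<^esub> g, \<alpha> (inv\<^bsub>G\<^esub> g) (inv\<^bsub>H\<^esub> h))"]) (auto simp: act)
  qed (auto simp: act)
qed

text \<open>Multiplying the claimed value by \<open>(g, h)\<close> in the first semidirect product makes \<open>\<alpha>(g)\<close> cancel
  \<open>\<alpha>(g\<^sup>-\<^sup>1)\<close> and leaves the product in the second one; this avoids computing the
  inverse of \<open>(g, h)\<close>.\<close>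

lemma semidirect_lambda:
  assumes G: "group G" and H: "group H"
    and \<alpha>: "\<alpha> \<in> hom G (AutoGroup H)" and \<beta>: "\<beta> \<in> hom G (AutoGroup H)"
    and "g \<in> carrier G" "h \<in> carrier H" "g' \<in> carrier G" "h' \<in> carrier H"
  shows "inv\<^bsub>semidirect G H \<alpha>\<^esub> (g, h) \<otimes>\<^bsub>semidirect G H \<alpha>\<^esub> ((g, h) \<otimes>\<^bsub>semidirect G H \<beta>\<^esub> (g', h'))
    = (g', \<alpha> (inv\<^bsub>G\<^esub> g) (\<beta> g h'))"
proof -
  interpret G: group G by (rule G)
  interpret H: group H by (rule H)
  interpret A: group "semidirect G H \<alpha>" by (rule group_semidirect[OF G H \<alpha>])
  note act\<alpha> = hom_AutoGroup_action(2-5)[OF G H \<alpha>]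
  note act\<beta> = hom_AutoGroup_action(2-5)[OF G H \<beta>]
  let ?t = "(g', \<alpha> (inv\<^bsub>G\<^esub> g) (\<beta> g h'))"
  have "\<alpha> g (\<alpha> (inv\<^bsub>G\<^esub> g) (\<beta> g h')) = \<beta> g h'"
    using assms by (simp add: act\<beta>(1) act\<alpha>(4) flip: act\<alpha>(3))
  then have "(g, h) \<otimes>\<^bsub>semidirect G H \<beta>\<^esub> (g', h') = (g, h) \<otimes>\<^bsub>semidirect G H \<alpha>\<^esub> ?t"
    by simp
  moreover have "(g, h) \<in> carrier (semidirect G H \<alpha>)" "?t \<in> carrier (semidirect G H \<alpha>)"
    using assms by (auto simp: act\<alpha>(1) act\<beta>(1))
  ultimately show ?thesis
    by (metis A.inv_closed A.l_inv A.l_one A.m_assoc)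
qed

text \<open>The two commutation hypotheses serve different steps in reducing
  \<open>\<alpha>(g k) \<circ> \<alpha>(g)\<^sup>-\<^sup>1 \<circ> \<beta>(g)\<close> to \<open>\<beta>(g) \<circ> \<alpha>(k)\<close>: commutation among the values of \<open>\<alpha>\<close> lets
  \<open>\<alpha>(g)\<close> cancel its inverse across \<open>\<alpha>(k)\<close>, and commutation
  between the values of \<open>\<alpha>\<close> and \<open>\<beta>\<close> then exchanges \<open>\<alpha>(k)\<close> and \<open>\<beta>(g)\<close>.\<close>

lemma skew_brace_semidirect:
  assumes G: "group G" and H: "group H"
    and \<alpha>: "\<alpha> \<in> hom G (AutoGroup H)" and \<beta>: "\<beta> \<in> hom G (AutoGroup H)"
  assumes comm: "\<And>x y h. \<lbrakk>x \<in> carrier G; y \<in> carrier G; h \<in> carrier H\<rbrakk> \<Longrightarrow> \<alpha> x (\<beta> y h) = \<beta> y (\<alpha> x h)"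
    and comm\<alpha>: "\<And>x y h. \<lbrakk>x \<in> carrier G; y \<in> carrier G; h \<in> carrier H\<rbrakk> \<Longrightarrow> \<alpha> x (\<alpha> y h) = \<alpha> y (\<alpha> x h)"
  shows "skew_brace (semidirect G H \<alpha>) (semidirect G H \<beta>)"
proof -
  interpret G: group G by (rule G)
  interpret H: group H by (rule H)
  interpret A: group "semidirect G H \<alpha>" by (rule group_semidirect[OF G H \<alpha>])
  interpret B: group "semidirect G H \<beta>" by (rule group_semidirect[OF G H \<beta>])
  note act\<alpha> = hom_AutoGroup_action(2-5)[OF G H \<alpha>]
  note act\<beta> = hom_AutoGroup_action(2-5)[OF G H \<beta>]
  show ?thesis
  proof unfold_locales
    fix a b c
    assume abc: "a \<in> carrier (semidirect G H \<alpha>)" "b \<in> carrier (semidirect G H \<alpha>)"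
      "c \<in> carrier (semidirect G H \<alpha>)"
    obtain g h k l g' h' where abc_eq: "a = (g, h)" "b = (k, l)" "c = (g', h')"
      by (metis prod.exhaust)
    with abc have in_carrier: "g \<in> carrier G" "h \<in> carrier H" "k \<in> carrier G" "l \<in> carrier H"
      "g' \<in> carrier G" "h' \<in> carrier H"
      by auto
    have "\<alpha> (g \<otimes>\<^bsub>G\<^esub> k) (\<alpha> (inv\<^bsub>G\<^esub> g) (\<beta> g h')) = \<alpha> k (\<alpha> g (\<alpha> (inv\<^bsub>G\<^esub> g) (\<beta> g h')))"
      using in_carrier by (simp add: act\<alpha>(1,3) act\<beta>(1) comm\<alpha>[of g k])
    also have "\<dots> = \<alpha> k (\<beta> g h')"
      using in_carrier by (simp add: act\<beta>(1) act\<alpha>(4) flip: act\<alpha>(3)[of g])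
    also have "\<dots> = \<beta> g (\<alpha> k h')"
      using in_carrier by (simp add: comm)
    finally have second_coordinate:
      "\<alpha> (g \<otimes>\<^bsub>G\<^esub> k) (\<alpha> (inv\<^bsub>G\<^esub> g) (\<beta> g h')) = \<beta> g (\<alpha> k h')" .
    have closed: "a \<otimes>\<^bsub>semidirect G H \<beta>\<^esub> b \<in> carrier (semidirect G H \<alpha>)"
      "a \<otimes>\<^bsub>semidirect G H \<beta>\<^esub> c \<in> carrier (semidirect G H \<alpha>)"
      using abc B.m_closed[of a] by simp_all
    have "(a \<otimes>\<^bsub>semidirect G H \<beta>\<^esub> b) \<otimes>\<^bsub>semidirect G H \<alpha>\<^esub> inv\<^bsub>semidirect G H \<alpha>\<^esub> a
        \<otimes>\<^bsub>semidirect G H \<alpha>\<^esub> (a \<otimes>\<^bsub>semidirect G H \<beta>\<^esub> c)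
      = (a \<otimes>\<^bsub>semidirect G H \<beta>\<^esub> b) \<otimes>\<^bsub>semidirect G H \<alpha>\<^esub> (g', \<alpha> (inv\<^bsub>G\<^esub> g) (\<beta> g h'))"
      using abc closed in_carrier semidirect_lambda[OF G H \<alpha> \<beta>, of g h g' h']
      by (simp only: A.m_assoc A.inv_closed abc_eq)
    also have "\<dots> = a \<otimes>\<^bsub>semidirect G H \<beta>\<^esub> (b \<otimes>\<^bsub>semidirect G H \<alpha>\<^esub> c)"
      using in_carrier
      by (simp add: abc_eq second_coordinate act\<alpha>(1) act\<beta>(1,2) G.m_assoc H.m_assoc)
    finally show "a \<otimes>\<^bsub>semidirect G H \<beta>\<^esub> (b \<otimes>\<^bsub>semidirect G H \<alpha>\<^esub> c) =
        (a \<otimes>\<^bsub>semidirect G H \<beta>\<^esub> b) \<otimes>\<^bsub>semidirect G H \<alpha>\<^esub> inv\<^bsub>semidirect G H \<alpha>\<^esub> a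
        \<otimes>\<^bsub>semidirect G H \<alpha>\<^esub> (a \<otimes>\<^bsub>semidirect G H \<beta>\<^esub> c)"
      by simp
  qed simp
qed

theorem proposition6p10:
  fixes G :: "('g, 'm) monoid_scheme" and H :: "('h, 'n) monoid_scheme"
    and M :: "('h \<Rightarrow> 'h) set"
  assumes "group G" and "group H"
    and "subgroup M (AutoGroup H)"
    and "comm_group (AutoGroup H\<lparr>carrier := M\<rparr>)"
  shows "brace_block (carrier G \<times> carrier H) (hom G (AutoGroup H\<lparr>carrier := M\<rparr>))
    (\<lambda>\<alpha>. semidirect G H \<alpha>)"
proof -
  interpret M: comm_group "AutoGroup H\<lparr>carrier := M\<rparr>" by (rule assms(4))
  have M_sub: "M \<subseteq> carrier (AutoGroup H)" by (rule subgroup.subset[OF assms(3)])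
  have hom: "\<alpha> \<in> hom G (AutoGroup H)" if "\<alpha> \<in> hom G (AutoGroup H\<lparr>carrier := M\<rparr>)" for \<alpha>
    using that M_sub by (auto simp: hom_def)
  have comm: "\<alpha> x (\<beta> y h) = \<beta> y (\<alpha> x h)"
    if "\<alpha> \<in> hom G (AutoGroup H\<lparr>carrier := M\<rparr>)" "\<beta> \<in> hom G (AutoGroup H\<lparr>carrier := M\<rparr>)"
      "x \<in> carrier G" "y \<in> carrier G" "h \<in> carrier H" for \<alpha> \<beta> x y h
  proof -
    have in_M: "\<alpha> x \<in> M" "\<beta> y \<in> M" using that by (auto simp: hom_def)
    then have "\<alpha> x \<otimes>\<^bsub>AutoGroup H\<^esub> \<beta> y = \<beta> y \<otimes>\<^bsub>AutoGroup H\<^esub> \<alpha> x"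
      using M.m_comm by simp
    moreover have "\<alpha> x \<in> carrier (AutoGroup H)" "\<beta> y \<in> carrier (AutoGroup H)"
      using in_M M_sub by auto
    ultimately show ?thesis
      using mult_AutoGroup_apply[of "\<alpha> x" H "\<beta> y" h] mult_AutoGroup_apply[of "\<beta> y" H "\<alpha> x" h]
        \<open>h \<in> carrier H\<close> by simp
  qed
  have "skew_brace (semidirect G H \<alpha>) (semidirect G H \<beta>)"
    if "\<alpha> \<in> hom G (AutoGroup H\<lparr>carrier := M\<rparr>)" "\<beta> \<in> hom G (AutoGroup H\<lparr>carrier := M\<rparr>)" for \<alpha> \<beta>
    by (rule skew_brace_semidirect[OF assms(1,2) hom[OF that(1)] hom[OF that(2)]
          comm[OF that] comm[OF that(1) that(1)]])
  then show ?thesis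
    using group_semidirect[OF assms(1,2) hom]
    by (simp add: brace_block_def bi_skew_brace_def)
qed

end
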